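(* Let $R$ be a commutative ring with identity and let $i\in\{1,2\}$. If $GA_i(R)$ is connected, then $\operatorname{diam}(GA_i(R))\leq 2n$, where $n$ is the smallest positive integer for which there is a collection of (not necessarily distinct) maximal ideals $\mathfrak{M}_1,\ldots,\mathfrak{M}_n$ of $R$ with $\mathfrak{M}_1\mathfrak{M}_2\cdots\mathfrak{M}_n=0$.
   Context: Both graphs are simple undirected graphs whose vertices are the proper ideals of $R$. In $GA_1(R)$ there is an edge between two distinct proper ideals if and only if, for one of the two orderings $(I,J)$ of the pair, there is a maximal ideal $\mathfrak{M}$ of $R$ with $I=J\mathfrak{M}$. In $GA_2(R)$ there is an edge between two distinct proper ideals if and only if, for one of the two orderings $(I,J)$ of the pair, the ideal $(I:_R J)=\{r\in R : rJ\subseteq I\}$ is a maximal ideal of $R$. The diameter $\operatorname{diam}$ of a graph is the supremum of the distances between pairs of vertices.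
   Formalization: For i=2 the bound is stated under the assumption that some finite product of maximal ideals is 0, since connectedness of GA_2(R) does not imply it (R = k × k[x], k a field, has connected GA_2(R) but no such n); for i=1 the existence of n is proved. *)

theory Defs
  imports
    "HOL-Algebra.Ideal_Product"
    "Graph_Theory.Graph_Theory"
begin

section \<open>Ideals\<close>

definition proper_ideals :: "('a, 'm) ring_scheme \<Rightarrow> 'a set set" where
  "proper_ideals R = {I. ideal I R \<and> I \<noteq> carrier R}"

definition colon_ideal :: "('a, 'm) ring_scheme \<Rightarrow> 'a set \<Rightarrow> 'a set \<Rightarrow> 'a set" where
  "colon_ideal R I J = {r \<in> carrier R. \<forall>x\<in>J. r \<otimes>\<^bsub>R\<^esub> x \<in> I}"

text \<open>
  The maximal ideals form a list, so repetitions are allowed. The unit ideal \<open>carrier R\<close> is the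
  product of the empty list.
\<close>

definition zero_is_maximal_product :: "('a, 'm) ring_scheme \<Rightarrow> nat \<Rightarrow> bool" where
  "zero_is_maximal_product R n \<longleftrightarrow>
     (\<exists>Ms. length Ms = n \<and> (\<forall>M \<in> set Ms. maximalideal M R) \<and>
           foldr (ideal_prod R) Ms (carrier R) = {\<zero>\<^bsub>R\<^esub>})"


section \<open>Graphs\<close>

text \<open>
  An undirected simple graph is a symmetric loop-free digraph without parallel arcs, as in the
  locale \<^locale>\<open>graph\<close>, but possibly infinite. The relation \<open>E\<close> need not be symmetric or
  irreflexive.
\<close>

definition simple_graph :: "'v set \<Rightarrow> ('v \<Rightarrow> 'v \<Rightarrow> bool) \<Rightarrow> ('v, 'v \<times> 'v) pre_digraph" where
  "simple_graph V E =
     \<lparr> verts = V,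
       arcs = {(u, v). u \<in> V \<and> v \<in> V \<and> u \<noteq> v \<and> (E u v \<or> E v u)},
       tail = fst, head = snd \<rparr>"

lemma wf_digraph_simple_graph: "wf_digraph (simple_graph V E)"
  by unfold_locales (auto simp: simple_graph_def)

lemma sym_digraph_simple_graph: "sym_digraph (simple_graph V E)"
  by (intro wf_digraph.sym_digraphI wf_digraph_simple_graph)
     (auto simp: symmetric_conv simple_graph_def)

text \<open>
  With unit weights \<^term>\<open>wf_digraph.\<mu> G\<close> is the usual distance (the least number of edges of a
  walk, and \<open>\<infinity>\<close> if there is none). It is meaningful only for \<^prop>\<open>wf_digraph G\<close>.
\<close>

definition graph_diameter :: "('v, 'e) pre_digraph \<Rightarrow> ereal" where
  "graph_diameter G = (SUP (u, v) \<in> verts G \<times> verts G. wf_digraph.\<mu> G (\<lambda>_. 1) u v)"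

definition GA1 :: "('a, 'm) ring_scheme \<Rightarrow> ('a set, 'a set \<times> 'a set) pre_digraph" where
  "GA1 R = simple_graph (proper_ideals R) (\<lambda>I J. \<exists>M. maximalideal M R \<and> I = ideal_prod R J M)"

definition GA2 :: "('a, 'm) ring_scheme \<Rightarrow> ('a set, 'a set \<times> 'a set) pre_digraph" where
  "GA2 R = simple_graph (proper_ideals R) (\<lambda>I J. maximalideal (colon_ideal R I J) R)"

text \<open>Only the indices 1 and 2 are meaningful.\<close>

definition GA :: "nat \<Rightarrow> ('a, 'm) ring_scheme \<Rightarrow> ('a set, 'a set \<times> 'a set) pre_digraph" where
  "GA i R = (if i = 1 then GA1 R else GA2 R)"

end

theory Submission
  imports Defs
begin

text \<open>
  Suppose \<open>M\<^sub>1 \<cdots> M\<^sub>n = 0\<close> with all \<open>M\<^sub>k\<close> maximal. Multiplying a proper ideal \<open>I\<close> by these ideals one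
  at a time gives the chain \<open>I, I M\<^sub>1, I M\<^sub>1 M\<^sub>2, \<dots>, I M\<^sub>1 \<cdots> M\<^sub>n = 0\<close>, in which two consecutive members
  are equal or adjacent. For the first graph this is the definition of adjacency; for the second,
  \<open>J M \<noteq> J\<close> forces \<open>(J M : J)\<close> to be a proper ideal above \<open>M\<close>, hence \<open>M\<close> itself (lemma
  \<open>colon_ideal_prod_maximal\<close>). So every vertex is at distance at most \<open>n\<close> from the vertex \<open>0\<close>, and
  any two vertices are at distance at most \<open>2n\<close>, by lemma \<open>graph_diameter_le_twice_radius\<close>. This
  holds for every such \<open>n\<close>, in particular for the least one.

  That such an \<open>n\<close> exists when the first graph is connected is a propagation argument. If \<open>I\<close>
  and \<open>J\<close> are adjacent there and \<open>J\<close> contains a product of maximal ideals, then so does \<open>I\<close>: either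
  \<open>I \<supseteq> J\<close>, or \<open>I = J M\<close> and the product only has to be prolonged by \<open>M\<close>. A maximal ideal contains
  such a product, hence by connectedness so does the ideal \<open>0\<close>. The maximal ideal to start from is
  read off the graph (lemma \<open>exists_maximal_ideal_if_GA1_connected\<close>).
\<close>

section \<open>Walks in simple graphs\<close>

lemma verts_simple_graph [simp]: "verts (simple_graph V E) = V"
  and tail_simple_graph [simp]: "tail (simple_graph V E) = fst"
  and head_simple_graph [simp]: "head (simple_graph V E) = snd"
  by (simp_all add: simple_graph_def)

lemma arcs_ends_simple_graph [simp]:
  "arcs_ends (simple_graph V E) = arcs (simple_graph V E)"
  by (auto simp: arcs_ends_def arc_to_ends_def simple_graph_def)

lemma swap_in_arcs_simple_graph:
  "e \<in> arcs (simple_graph V E) \<Longrightarrow> prod.swap e \<in> arcs (simple_graph V E)"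
  by (auto simp: simple_graph_def)

lemma awalk_simple_graph_rev:
  assumes "pre_digraph.awalk (simple_graph V E) u p v"
  shows "pre_digraph.awalk (simple_graph V E) v (rev (map prod.swap p)) u"
proof -
  interpret wf_digraph "simple_graph V E" by (rule wf_digraph_simple_graph)
  show ?thesis using assms
  proof (induction p arbitrary: u)
    case Nil
    then have "u = v" "u \<in> verts (simple_graph V E)" by (auto simp only: awalk_Nil_iff)
    then show ?case by (auto simp: awalk_Nil_iff simp del: verts_simple_graph)
  next
    case (Cons e p)
    then have e: "e \<in> arcs (simple_graph V E)" "u = fst e" and p: "awalk (snd e) p v"
      by (auto simp: awalk_Cons_iff)
    have "u \<in> V" using e by (auto simp: simple_graph_def)
    then have "awalk (snd e) [prod.swap e] u"
      using swap_in_arcs_simple_graph[OF e(1)] e(2) by (simp add: awalk_simps)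
    with Cons.IH[OF p] show ?case by (simp add: awalk_appendI)
  qed
qed

text \<open>
  Two vertices are joined by walking from one to the centre \<open>z\<close> and then back along the reversed walk
  of the other.
\<close>

lemma graph_diameter_le_twice_radius:
  fixes V :: "'v set"
  assumes "\<And>u. u \<in> V \<Longrightarrow> \<exists>p. pre_digraph.awalk (simple_graph V E) u p z \<and> length p \<le> n"
  shows "graph_diameter (simple_graph V E) \<le> ereal (2 * real n)"
proof -
  interpret wf_digraph "simple_graph V E" by (rule wf_digraph_simple_graph)
  have unit_cost: "awalk_cost (\<lambda>_. 1) p = real (length p)" for p :: "('v \<times> 'v) list"
    by (induction p) simp_all
  have "\<mu> (\<lambda>_. 1) u v \<le> ereal (2 * real n)" if uv: "u \<in> V" "v \<in> V" for u v
  proof -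
    obtain p q where p: "awalk u p z" "length p \<le> n" and q: "awalk v q z" "length q \<le> n"
      using assms[OF uv(1)] assms[OF uv(2)] by blast
    have "awalk u (p @ rev (map prod.swap q)) v"
      using p(1) awalk_simple_graph_rev[OF q(1)] by (rule awalk_appendI)
    from min_cost_le_walk_cost[OF this, of "\<lambda>_. 1"]
    have "\<mu> (\<lambda>_. 1) u v \<le> ereal (real (length p + length q))"
      by (simp add: unit_cost)
    also have "\<dots> \<le> ereal (2 * real n)"
      using p(2) q(2) by simp
    finally show ?thesis .
  qed
  then show ?thesis
    unfolding graph_diameter_def by (auto intro!: SUP_least)
qed

lemma reachable_if_connected_simple_graph:
  assumes "Digraph_Component.connected (simple_graph V E)" "u \<in> V" "v \<in> V"
  shows "(u, v) \<in> (arcs (simple_graph V E))\<^sup>*"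
proof -
  interpret sym_digraph "simple_graph V E" by (rule sym_digraph_simple_graph)
  have "u \<rightarrow>\<^sup>*\<^bsub>with_proj (mk_symmetric (simple_graph V E))\<^esub> v"
    using assms by (auto simp: connected_def strongly_connected_def)
  then have "u \<rightarrow>\<^sup>*\<^bsub>simple_graph V E\<^esub> v"
    using reachable_mk_symmetric_eq[OF sym_arcs] by blast
  then show ?thesis
    using reachable_rtranclI by fastforce
qed


section \<open>Products of ideals and adjacency\<close>

lemma ideal_prod_mono:
  assumes "I \<subseteq> I'" "J \<subseteq> J'"
  shows "ideal_prod R I J \<subseteq> ideal_prod R I' J'"
proof
  fix x assume "x \<in> ideal_prod R I J"
  then show "x \<in> ideal_prod R I' J'"
    by induction (use assms in \<open>auto intro: ideal_prod.intros\<close>)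
qed

context cring
begin

lemma ideal_foldr_ideal_prod:
  assumes "\<forall>M \<in> set Ms. maximalideal M R"
  shows "ideal (foldr (ideal_prod R) Ms (carrier R)) R"
  using assms
  by (induction Ms) (auto intro: oneideal ideal_prod_is_ideal maximalideal.axioms(1))

lemma proper_ideal_prod:
  assumes "I \<in> proper_ideals R" "ideal M R"
  shows "ideal_prod R I M \<in> proper_ideals R"
proof -
  have I: "ideal I R" "I \<noteq> carrier R" using assms(1) by (auto simp: proper_ideals_def)
  have "ideal_prod R I M \<subseteq> I" using ideal_prod_inter[OF I(1) assms(2)] by blast
  with I have "ideal_prod R I M \<noteq> carrier R"
    using ideal.Icarr[OF I(1)] by blast
  then show ?thesis
    using ideal_prod_is_ideal[OF I(1) assms(2)] by (simp add: proper_ideals_def)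
qed

lemma zero_in_proper_ideals:
  assumes "proper_ideals R \<noteq> {}"
  shows "{\<zero>} \<in> proper_ideals R"
proof -
  obtain I where I: "ideal I R" "I \<noteq> carrier R"
    using assms by (auto simp: proper_ideals_def)
  have "\<zero> \<in> I" "I \<subseteq> carrier R"
    using I(1) by (auto simp: additive_subgroup.zero_closed ideal.axioms(1) ideal.Icarr)
  with I(2) have "carrier R \<noteq> {\<zero>}" by auto
  then show ?thesis using zeroideal by (auto simp: proper_ideals_def)
qed

lemma ideal_colon_ideal:
  assumes "ideal I R" "ideal J R"
  shows "ideal (colon_ideal R I J) R"
proof -
  interpret I: ideal I R by fact
  interpret J: ideal J R by fact
  show ?thesis
  proof (rule idealI)
    show "subgroup (colon_ideal R I J) (add_monoid R)"
    proof (rule add.subgroupI)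
      show "colon_ideal R I J \<noteq> {}"
        by (auto simp: colon_ideal_def intro!: exI[of _ \<zero>])
    qed (auto simp: colon_ideal_def l_minus l_distr J.Icarr)
  qed (auto simp: colon_ideal_def m_assoc J.Icarr I.I_l_closed J.I_l_closed ring_axioms)
qed

text \<open>
  The colon ideal \<open>(J M : J)\<close> contains \<open>M\<close>, and it is proper because \<open>1 \<in> (J M : J)\<close> would mean
  \<open>J \<subseteq> J M\<close>.
\<close>

lemma colon_ideal_prod_maximal:
  assumes J: "ideal J R" and M: "maximalideal M R" and ne: "ideal_prod R J M \<noteq> J"
  shows "colon_ideal R (ideal_prod R J M) J = M"
proof -
  interpret M: maximalideal M R by fact
  interpret J: ideal J R by fact
  let ?C = "colon_ideal R (ideal_prod R J M) J"
  have C: "ideal ?C R"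
    using J M.is_ideal by (intro ideal_colon_ideal ideal_prod_is_ideal)
  have "M \<subseteq> ?C"
  proof
    fix m assume m: "m \<in> M"
    have "m \<otimes> x \<in> ideal_prod R J M" if "x \<in> J" for x
      using ideal_prod.prod[OF that m, of R] that m by (simp add: m_comm J.Icarr M.Icarr)
    with m show "m \<in> ?C" by (simp add: colon_ideal_def M.Icarr)
  qed
  moreover have "?C \<noteq> carrier R"
  proof
    assume "?C = carrier R"
    then have "\<one> \<in> ?C" by simp
    then have "J \<subseteq> ideal_prod R J M"
      by (auto simp: colon_ideal_def J.Icarr)
    with ne ideal_prod_inter[OF J M.is_ideal] show False by blast
  qed
  ultimately show ?thesis
    using M.I_maximal[OF C] by (auto simp: colon_ideal_def)
qed

lemma ideal_prod_adjacent_GA: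
  assumes "I \<in> proper_ideals R" "maximalideal M R" "ideal_prod R I M \<noteq> I"
  shows "(I, ideal_prod R I M) \<in> arcs (GA i R)"
proof -
  have "ideal_prod R I M \<in> proper_ideals R"
    using assms(1,2) by (simp add: proper_ideal_prod maximalideal.axioms(1))
  moreover have "maximalideal (colon_ideal R (ideal_prod R I M) I) R"
    using assms by (simp add: colon_ideal_prod_maximal proper_ideals_def)
  ultimately show ?thesis
    using assms by (auto simp: GA_def GA1_def GA2_def simple_graph_def)
qed

lemma GA_simple_graphE:
  obtains E where "GA i R = simple_graph (proper_ideals R) E"
  by (cases "i = 1") (auto simp: GA_def GA1_def GA2_def)

text \<open>
  The walk \<open>I, I M\<^sub>1, I M\<^sub>1 M\<^sub>2, \<dots>\<close>. The product in the end point associates to the right, whereas the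
  walk multiplies from the left; associativity reconciles the two. A step that leaves the ideal
  unchanged contributes no arc, hence the inequality.
\<close>

lemma walk_to_maximal_product:
  assumes "I \<in> proper_ideals R" "\<forall>M \<in> set Ms. maximalideal M R"
  shows "\<exists>p. pre_digraph.awalk (GA i R) I p
               (ideal_prod R I (foldr (ideal_prod R) Ms (carrier R))) \<and> length p \<le> length Ms"
proof -
  obtain E where E: "GA i R = simple_graph (proper_ideals R) E"
    by (rule GA_simple_graphE)
  interpret wf_digraph "GA i R"
    unfolding E by (rule wf_digraph_simple_graph)
  show ?thesis using assms
  proof (induction Ms arbitrary: I)
    case Nil
    then have "awalk I [] I"
      by (simp add: awalk_Nil_iff) (simp add: E)
    then show ?case
      using Nil.prems by (auto simp: ideal_prod_one proper_ideals_def)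
  next
    case (Cons M Ms)
    let ?P = "foldr (ideal_prod R) Ms (carrier R)"
    have I: "ideal I R" and M: "ideal M R" and P: "ideal ?P R"
      using Cons.prems
      by (auto simp: proper_ideals_def maximalideal.axioms(1) intro: ideal_foldr_ideal_prod)
    have assoc: "ideal_prod R I (ideal_prod R M ?P) = ideal_prod R (ideal_prod R I M) ?P"
      using ideal_prod_assoc[OF I M P] by simp
    have "ideal_prod R I M \<in> proper_ideals R"
      using Cons.prems M by (simp add: proper_ideal_prod)
    then obtain p where p: "awalk (ideal_prod R I M) p (ideal_prod R (ideal_prod R I M) ?P)"
      "length p \<le> length Ms"
      using Cons.IH Cons.prems by force
    show ?case
    proof (cases "ideal_prod R I M = I")
      case True
      with p assoc show ?thesis by (auto intro!: exI[of _ p])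
    next
      case False
      with Cons.prems have "(I, ideal_prod R I M) \<in> arcs (GA i R)"
        by (simp add: ideal_prod_adjacent_GA)
      with p have "awalk I ((I, ideal_prod R I M) # p) (ideal_prod R (ideal_prod R I M) ?P)"
        by (simp add: awalk_Cons_iff) (simp add: E)
      with p(2) assoc show ?thesis
        by (intro exI[of _ "(I, ideal_prod R I M) # p"]) simp
    qed
  qed
qed

lemma graph_diameter_GA_le:
  assumes "zero_is_maximal_product R n"
  shows "graph_diameter (GA i R) \<le> ereal (2 * real n)"
proof -
  obtain Ms where Ms: "length Ms = n" "\<forall>M \<in> set Ms. maximalideal M R"
      "foldr (ideal_prod R) Ms (carrier R) = {\<zero>}"
    using assms by (auto simp: zero_is_maximal_product_def)
  obtain E where E: "GA i R = simple_graph (proper_ideals R) E"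
    by (rule GA_simple_graphE)
  have "\<exists>p. pre_digraph.awalk (GA i R) I p {\<zero>} \<and> length p \<le> n" if "I \<in> proper_ideals R" for I
    using walk_to_maximal_product[OF that Ms(2), of i] that Ms
    by (simp add: ideal_prod_zero proper_ideals_def)
  then show ?thesis
    unfolding E by (rule graph_diameter_le_twice_radius)
qed


section \<open>Connectedness makes zero a product of maximal ideals\<close>

text \<open>
  If \<open>0\<close> is the only proper ideal, then it is maximal. Otherwise a walk from \<open>0\<close> to another vertex has
  an edge, and each edge comes with the maximal ideal that defines it.
\<close>

lemma exists_maximal_ideal_if_GA1_connected:
  assumes "Digraph_Component.connected (GA1 R)" "{\<zero>} \<in> proper_ideals R"
  shows "\<exists>M. maximalideal M R"
proof (cases "proper_ideals R = {{\<zero>}}")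
  case True
  have "maximalideal {\<zero>} R"
  proof (rule maximalidealI)
    show "J = {\<zero>} \<or> J = carrier R" if "ideal J R" for J
      using True that by (auto simp: proper_ideals_def)
  qed (use assms(2) in \<open>auto simp: proper_ideals_def\<close>)
  then show ?thesis ..
next
  case False
  then obtain J where "J \<in> proper_ideals R" "J \<noteq> {\<zero>}"
    using assms(2) by blast
  moreover from this have "({\<zero>}, J) \<in> (arcs (GA1 R))\<^sup>*"
    using assms unfolding GA1_def by (intro reachable_if_connected_simple_graph)
  ultimately obtain e where "e \<in> arcs (GA1 R)"
    by (metis rtranclE)
  then show ?thesis by (auto simp: GA1_def simple_graph_def)
qed

definition contains_maximal_product :: "'a set \<Rightarrow> bool" where
  "contains_maximal_product I \<longleftrightarrow>
     (\<exists>Ms. (\<forall>M \<in> set Ms. maximalideal M R) \<and> foldr (ideal_prod R) Ms (carrier R) \<subseteq> I)"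

lemma contains_maximal_product_mult:
  assumes "contains_maximal_product J" "ideal J R" "maximalideal M R"
  shows "contains_maximal_product (ideal_prod R J M)"
proof -
  obtain Ms where Ms: "\<forall>M \<in> set Ms. maximalideal M R" "foldr (ideal_prod R) Ms (carrier R) \<subseteq> J"
    using assms(1) by (auto simp: contains_maximal_product_def)
  have "foldr (ideal_prod R) (M # Ms) (carrier R) \<subseteq> ideal_prod R M J"
    using Ms(2) by (simp add: ideal_prod_mono)
  also have "\<dots> = ideal_prod R J M"
    using assms(2) maximalideal.axioms(1)[OF assms(3)] by (simp add: ideal_prod_commute)
  finally show ?thesis
    unfolding contains_maximal_product_def using Ms(1) assms(3)
    by (intro exI[of _ "M # Ms"]) auto
qed

text \<open>
  Along an edge one ideal is the other times a maximal ideal. Stepping to the larger ideal keeps the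
  contained product, stepping to the smaller one multiplies it by that maximal ideal.
\<close>

lemma contains_maximal_product_adjacent:
  assumes "contains_maximal_product J" "(J, I) \<in> arcs (GA1 R)"
  shows "contains_maximal_product I"
proof -
  have ideals: "ideal I R" "ideal J R"
    using assms(2) by (auto simp: GA1_def simple_graph_def proper_ideals_def)
  obtain M where M: "maximalideal M R" "I = ideal_prod R J M \<or> J = ideal_prod R I M"
    using assms(2) by (auto simp: GA1_def simple_graph_def)
  from M(2) show ?thesis
  proof
    assume "I = ideal_prod R J M"
    then show ?thesis using assms(1) ideals M(1) by (simp add: contains_maximal_product_mult)
  next
    assume "J = ideal_prod R I M"
    then have "J \<subseteq> I"
      using ideal_prod_inter[OF ideals(1) maximalideal.axioms(1)[OF M(1)]] by blast
    then show ?thesis using assms(1) by (auto simp: contains_maximal_product_def)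
  qed
qed

lemma zero_is_maximal_product_if_GA1_connected:
  assumes "Digraph_Component.connected (GA1 R)"
  shows "\<exists>n>0. zero_is_maximal_product R n"
proof -
  have "proper_ideals R \<noteq> {}"
    using assms by (auto simp: GA1_def connected_def strongly_connected_def)
  then have zero: "{\<zero>} \<in> proper_ideals R"
    by (rule zero_in_proper_ideals)
  obtain M where M: "maximalideal M R"
    using exists_maximal_ideal_if_GA1_connected[OF assms zero] ..
  then interpret M: maximalideal M R .
  have start: "contains_maximal_product M"
    unfolding contains_maximal_product_def using M
    by (intro exI[of _ "[M]"]) (simp add: ideal_prod_one M.is_ideal)
  have "(M, {\<zero>}) \<in> (arcs (GA1 R))\<^sup>*"
    using assms zero M.is_ideal M.I_notcarr unfolding GA1_def
    by (intro reachable_if_connected_simple_graph) (auto simp: proper_ideals_def)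
  then have "contains_maximal_product {\<zero>}"
    by (induction rule: rtrancl_induct) (rule start, rule contains_maximal_product_adjacent)
  then obtain Ms where Ms: "\<forall>M \<in> set Ms. maximalideal M R"
    and sub: "foldr (ideal_prod R) Ms (carrier R) \<subseteq> {\<zero>}"
    by (auto simp: contains_maximal_product_def)
  have eq: "foldr (ideal_prod R) Ms (carrier R) = {\<zero>}"
    using sub additive_subgroup.zero_closed[OF ideal.axioms(1)[OF ideal_foldr_ideal_prod[OF Ms]]]
    by blast
  \<comment> \<open>The empty product is the unit ideal, which differs from zero as a proper ideal exists.\<close>
  have "Ms \<noteq> []"
  proof
    assume "Ms = []"
    with eq zero show False by (simp add: proper_ideals_def)
  qed
  with Ms eq show ?thesis
    unfolding zero_is_maximal_product_def by (intro exI[of _ "length Ms"]) auto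
qed

end

theorem corollary3p17:
  fixes R :: "('a, 'm) ring_scheme" and i :: nat
  assumes "cring R"
    and "i \<in> {1, 2}"
    and "Digraph_Component.connected (GA i R)"
  shows "(i = 1 \<longrightarrow> (\<exists>n>0. zero_is_maximal_product R n)) \<and>
    ((\<exists>n>0. zero_is_maximal_product R n) \<longrightarrow>
      graph_diameter (GA i R) \<le> ereal (2 * real (LEAST n. 0 < n \<and> zero_is_maximal_product R n)))"
proof (intro conjI impI)
  interpret cring R by fact
  show "\<exists>n>0. zero_is_maximal_product R n" if "i = 1"
    using assms(3) that zero_is_maximal_product_if_GA1_connected by (simp add: GA_def)
  assume "\<exists>n>0. zero_is_maximal_product R n"
  then have "zero_is_maximal_product R (LEAST n. 0 < n \<and> zero_is_maximal_product R n)"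
    by (metis (mono_tags, lifting) LeastI)
  then show "graph_diameter (GA i R) \<le>
      ereal (2 * real (LEAST n. 0 < n \<and> zero_is_maximal_product R n))"
    by (rule graph_diameter_GA_le)
qed

end
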